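(* For every matrix $M \in \mathbb{R}^{n \times n}$ with $M \neq 0$, one has $$\xi(M)\,\mu(M) \geq 1.$$
   Context: All matrices are real $n \times n$. $\|\cdot\|$ denotes the spectral norm (largest singular value) and $\|\cdot\|_\infty$ denotes the largest absolute value of an entry. For a matrix $M$ of rank $k$ with (compact) singular value decomposition $M = U\Sigma V^T$, $U,V \in \mathbb{R}^{n\times k}$, define the subspace of $\mathbb{R}^{n\times n}$ $$T(M) = \{U X^T + Y V^T : X, Y \in \mathbb{R}^{n \times k}\}.$$ Define the subspace $$\Omega(M) = \{N \in \mathbb{R}^{n\times n} : \mathrm{support}(N) \subseteq \mathrm{support}(M)\},$$ where $\mathrm{support}(M)$ is the set of index pairs $(i,j)$ with $M_{i,j}\neq 0$. Define $$\xi(M) = \max_{N \in T(M),\ \|N\| \leq 1} \|N\|_\infty, \qquad \mu(M) = \max_{N \in \Omega(M),\ \|N\|_\infty \leq 1} \|N\|.$$ *)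

theory Defs
  imports "HOL-Analysis.Analysis"
begin

definition entry_norm :: "real^'n^'n \<Rightarrow> real" where
  "entry_norm A = Max {\<bar>A $ i $ j\<bar> | i j. True}"

definition singular_value :: "real^'n^'n \<Rightarrow> real \<Rightarrow> bool" where
  "singular_value A s \<longleftrightarrow>
     0 \<le> s \<and> (\<exists>v. v \<noteq> 0 \<and> (transpose A ** A) *v v = s\<^sup>2 *\<^sub>R v)"

definition spectral_norm :: "real^'n^'n \<Rightarrow> real" where
  "spectral_norm A = (GREATEST s. singular_value A s)"

text \<open>
  The number of columns k of a factor of a compact singular value decomposition
  depends on the matrix, so an n by k matrix is represented by its columns
  \<open>A 0, \<dots>, A (k - 1)\<close>; values at other indices are ignored. The following is
  the n by n matrix product of A with the transpose of B.
\<close>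

definition mult_transpose :: "nat \<Rightarrow> (nat \<Rightarrow> real^'n) \<Rightarrow> (nat \<Rightarrow> real^'n) \<Rightarrow> real^'n^'n" where
  "mult_transpose k A B = (\<chi> i j. \<Sum>l<k. A l $ i * B l $ j)"

definition orthonormal_columns :: "nat \<Rightarrow> (nat \<Rightarrow> real^'n) \<Rightarrow> bool" where
  "orthonormal_columns k A \<longleftrightarrow>
     (\<forall>l<k. \<forall>m<k. A l \<bullet> A m = (if l = m then 1 else 0))"

text \<open>
  The diagonal matrix is given by its diagonal entries \<open>\<sigma>\<close>; multiplying U by it
  on the right scales the columns of U.
\<close>

definition compact_svd ::
    "real^'n^'n \<Rightarrow> nat \<Rightarrow> (nat \<Rightarrow> real^'n) \<Rightarrow> (nat \<Rightarrow> real) \<Rightarrow> (nat \<Rightarrow> real^'n) \<Rightarrow> bool" where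
  "compact_svd M k U \<sigma> V \<longleftrightarrow>
     k = rank M \<and> orthonormal_columns k U \<and> orthonormal_columns k V \<and>
     (\<forall>l<k. 0 < \<sigma> l) \<and>
     M = mult_transpose k (\<lambda>l. \<sigma> l *\<^sub>R U l) V"

text \<open>
  The space attached to a decomposition depends only on the column spaces of U and V,
  which are the column space and the row space of M. All decompositions of M therefore
  give the same space, and quantifying over them existentially makes no choice.
\<close>

definition T_space :: "real^'n^'n \<Rightarrow> (real^'n^'n) set" where
  "T_space M = {mult_transpose k U X + mult_transpose k Y V | k U \<sigma> V X Y.
     compact_svd M k U \<sigma> V}"

definition support :: "real^'n^'n \<Rightarrow> ('n \<times> 'n) set" where
  "support M = {(i, j). M $ i $ j \<noteq> 0}"

definition Omega_space :: "real^'n^'n \<Rightarrow> (real^'n^'n) set" where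
  "Omega_space M = {N. support N \<subseteq> support M}"

text \<open>
  The maxima below exist: each is taken of a continuous function over a nonempty
  compact set.
\<close>

definition xi :: "real^'n^'n \<Rightarrow> real" where
  "xi M = (GREATEST r. \<exists>N \<in> T_space M. spectral_norm N \<le> 1 \<and> r = entry_norm N)"

definition mu :: "real^'n^'n \<Rightarrow> real" where
  "mu M = (GREATEST r. \<exists>N \<in> Omega_space M. entry_norm N \<le> 1 \<and> r = spectral_norm N)"

end

theory Submission
  imports Defs
begin

text \<open>
  M lies in both \<open>T(M)\<close> and \<open>\<Omega>(M)\<close>. Rescaling it to spectral norm 1 gives
  \<open>\<xi>(M) \<ge> \<parallel>M\<parallel>\<^sub>\<infinity> / \<parallel>M\<parallel>\<close>, and rescaling it to largest entry 1 gives
  \<open>\<mu>(M) \<ge> \<parallel>M\<parallel> / \<parallel>M\<parallel>\<^sub>\<infinity>\<close>. The maxima are attained, since both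
  norms are continuous with bounded unit balls and both spaces are closed.
\<close>

section \<open>Spectral norm as operator norm\<close>

declare transpose_matrix_vector [simp del]

lemma inner_matrix_transpose:
  fixes A :: "real^'n^'n"
  shows "(A *v x) \<bullet> y = x \<bullet> (transpose A *v y)"
  by (metis dot_lmul_matrix inner_commute vector_transpose_matrix transpose_transpose)

text \<open>With \<open>w = transpose A *v y\<close>, the square of \<open>norm w\<close> equals
  \<open>(A *v w) \<bullet> y\<close>. Cauchy-Schwarz bounds this by
  \<open>s * norm w * norm y\<close>, and one factor \<open>norm w\<close> cancels.\<close>

lemma norm_transpose_mult_le:
  fixes A :: "real^'n^'n"
  assumes "\<And>x. norm (A *v x) \<le> s * norm x"
  shows "norm (transpose A *v y) \<le> s * norm y"
proof (cases "transpose A *v y = 0")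
  case True
  have "0 \<le> s * norm y" using assms norm_ge_zero order_trans by blast
  then show ?thesis using True by simp
next
  case False
  let ?w = "transpose A *v y"
  have "norm ?w * norm ?w = (A *v ?w) \<bullet> y"
    by (simp only: inner_matrix_transpose flip: power2_norm_eq_inner power2_eq_square)
  also have "\<dots> \<le> norm (A *v ?w) * norm y" by (rule norm_cauchy_schwarz)
  also have "\<dots> \<le> s * norm ?w * norm y" by (intro mult_right_mono assms) auto
  finally have "norm ?w * norm ?w \<le> norm ?w * (s * norm y)" by (simp add: ac_simps)
  then show ?thesis using False by simp
qed

text \<open>A maximizer \<open>v\<close> of \<open>norm (A *v x)\<close> on the unit sphere works.
  No spectral theorem enters: for \<open>w = transpose A *v (A *v v)\<close>, both
  \<open>w \<bullet> v = s * s\<close> and \<open>norm w \<le> s * s\<close> hold, which is the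
  equality case of Cauchy-Schwarz and forces \<open>w\<close> to be a multiple of
  \<open>v\<close>.\<close>

lemma right_singular_vector_exists:
  fixes A :: "real^'n^'n"
  defines "s \<equiv> onorm ((*v) A)"
  obtains v where "norm v = 1" "transpose A *v (A *v v) = s\<^sup>2 *\<^sub>R v"
proof -
  have bl: "bounded_linear ((*v) A)" by (simp add: matrix_vector_mul_bounded_linear)
  have "compact (sphere 0 1 :: (real^'n) set)" "sphere 0 1 \<noteq> ({} :: (real^'n) set)" by auto
  moreover have "continuous_on (sphere 0 1) (\<lambda>x. norm (A *v x))"
    by (intro continuous_intros)
  ultimately obtain v where v: "norm v = 1" and max: "\<And>x. norm x = 1 \<Longrightarrow> norm (A *v x) \<le> norm (A *v v)"
    using continuous_attains_sup[of "sphere 0 1 :: (real^'n) set" "\<lambda>x. norm (A *v x)"] by auto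
  have le: "norm (A *v x) \<le> s * norm x" for x
    unfolding s_def by (rule onorm[OF bl])
  have "s \<le> norm (A *v v)"
    unfolding s_def
  proof (rule onorm_le)
    fix x
    show "norm (A *v x) \<le> norm (A *v v) * norm x"
    proof (cases "x = 0")
      case False
      have "norm (A *v ((1 / norm x) *\<^sub>R x)) \<le> norm (A *v v)"
        by (rule max) (use False in simp)
      then show ?thesis using False by (simp add: matrix_vector_mult_scaleR field_simps)
    qed simp
  qed
  with le[of v] v have nv: "norm (A *v v) = s" by simp
  let ?w = "transpose A *v (A *v v)"
  have wv: "?w \<bullet> v = s\<^sup>2"
    by (metis inner_commute inner_matrix_transpose nv power2_norm_eq_inner)
  have "norm ?w \<le> s * s"
    using norm_transpose_mult_le[OF le, of "A *v v"] nv by simp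
  then have w2: "?w \<bullet> ?w \<le> (s\<^sup>2)\<^sup>2"
    by (metis norm_ge_zero power2_eq_square power2_norm_eq_inner power_mono)
  \<comment> \<open>Expanding the squared distance between the two sides shows that it is at most
    0.\<close>
  have "(norm (?w - s\<^sup>2 *\<^sub>R v))\<^sup>2 = ?w \<bullet> ?w - 2 * s\<^sup>2 * (?w \<bullet> v) + (s\<^sup>2)\<^sup>2 * (v \<bullet> v)"
    unfolding power2_norm_eq_inner
    by (simp add: inner_diff inner_commute[of v ?w] power2_eq_square[of "s\<^sup>2"] algebra_simps)
  also have "\<dots> = ?w \<bullet> ?w - (s\<^sup>2)\<^sup>2"
    using wv v by (simp add: power2_eq_square algebra_simps flip: power2_norm_eq_inner)
  finally have "(norm (?w - s\<^sup>2 *\<^sub>R v))\<^sup>2 \<le> 0" using w2 by simp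
  then have "?w = s\<^sup>2 *\<^sub>R v" by simp
  with v show ?thesis by (rule that)
qed

text \<open>The operator norm is itself a singular value by the preceding lemma. It is the greatest,
  because a vector \<open>v\<close> belonging to a singular value \<open>s\<close> satisfies
  \<open>norm (A *v v) = s * norm v\<close>.\<close>

lemma spectral_norm_eq_onorm: "spectral_norm A = onorm ((*v) A)"
  unfolding spectral_norm_def
proof (rule Greatest_equality)
  obtain v where "norm v = 1" "transpose A *v (A *v v) = (onorm ((*v) A))\<^sup>2 *\<^sub>R v"
    by (rule right_singular_vector_exists)
  then show "singular_value A (onorm ((*v) A))"
    unfolding singular_value_def
    by (auto simp: matrix_vector_mul_assoc intro!: onorm_pos_le exI[of _ v])
next
  fix s assume "singular_value A s"
  then obtain v where s: "0 \<le> s" and v: "v \<noteq> 0" "transpose A *v (A *v v) = s\<^sup>2 *\<^sub>R v"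
    by (auto simp: singular_value_def matrix_vector_mul_assoc)
  have "(norm (A *v v))\<^sup>2 = v \<bullet> (transpose A *v (A *v v))"
    by (simp add: power2_norm_eq_inner flip: inner_matrix_transpose)
  also have "\<dots> = (s * norm v)\<^sup>2"
    by (simp add: v power_mult_distrib power2_norm_eq_inner)
  finally have "s * norm v = norm (A *v v)" using s by simp
  also have "\<dots> \<le> onorm ((*v) A) * norm v" by (rule onorm) simp
  finally show "s \<le> onorm ((*v) A)" using v by simp
qed

section \<open>Scaling and comparison of the two norms\<close>

lemma entry_norm_eq_Max_range: "entry_norm A = Max (range (\<lambda>(i, j). \<bar>A $ i $ j\<bar>))"
  unfolding entry_norm_def by (rule arg_cong[of _ _ Max]) auto

lemma entry_norm_le_iff: "entry_norm A \<le> c \<longleftrightarrow> (\<forall>i j. \<bar>A $ i $ j\<bar> \<le> c)"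
  unfolding entry_norm_eq_Max_range by auto

lemma abs_entry_le_entry_norm: "\<bar>A $ i $ j\<bar> \<le> entry_norm A"
  using entry_norm_le_iff by blast

lemma entry_norm_scaleR: "entry_norm (c *\<^sub>R A) = \<bar>c\<bar> * entry_norm A"
proof -
  have "range (\<lambda>(i, j). \<bar>(c *\<^sub>R A) $ i $ j\<bar>) = (*) \<bar>c\<bar> ` range (\<lambda>(i, j). \<bar>A $ i $ j\<bar>)"
    by (auto simp: abs_mult image_image intro!: image_cong)
  then show ?thesis
    unfolding entry_norm_eq_Max_range
    by (simp add: mono_Max_commute[symmetric] mono_def mult_left_mono)
qed

lemma spectral_norm_scaleR: "spectral_norm (c *\<^sub>R A) = \<bar>c\<bar> * spectral_norm A"
proof -
  have "(*v) (c *\<^sub>R A) = (\<lambda>x. c *\<^sub>R (A *v x))"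
    by (simp add: fun_eq_iff scaleR_matrix_vector_assoc)
  then show ?thesis by (simp add: spectral_norm_eq_onorm onorm_scaleR)
qed

text \<open>Each entry is the inner product of a basis vector with the image of a basis vector. The
  comparison later gives boundedness of the spectral unit ball and positivity of the spectral norm
  of a nonzero matrix.\<close>

lemma entry_norm_le_spectral_norm: "entry_norm A \<le> spectral_norm A"
  by (simp add: entry_norm_le_iff spectral_norm_eq_onorm matrix_component_le_onorm)

section \<open>Continuity, compactness and attained maxima\<close>

text \<open>Subadditivity gives \<open>f x - f y \<le> f (x - y)\<close>, so the linear bound turns
  into a Lipschitz bound.\<close>

lemma continuous_on_seminorm:
  fixes f :: "'a::real_normed_vector \<Rightarrow> real"
  assumes triangle: "\<And>x y. f (x + y) \<le> f x + f y" and bound: "\<And>x. f x \<le> C * norm x"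
  shows "continuous_on S f"
proof (rule continuous_on_subset[OF lipschitz_on_continuous_on])
  \<comment> \<open>A Lipschitz constant has to be nonnegative, whereas \<open>C\<close> is
    arbitrary.\<close>
  show "(max C 0)-lipschitz_on UNIV f"
  proof (rule lipschitz_onI)
    fix x y
    have *: "f x - f y \<le> max C 0 * norm (x - y)" for x y
      using triangle[of "x - y" y] bound[of "x - y"] mult_right_mono[of C "max C 0" "norm (x - y)"]
      by simp
    show "dist (f x) (f y) \<le> max C 0 * dist x y"
      using *[of x y] *[of y x] by (simp add: dist_norm norm_minus_commute abs_le_iff)
  qed simp
qed simp

lemma continuous_on_entry_norm: "continuous_on S entry_norm"
proof (rule continuous_on_seminorm)
  fix A B :: "real^'n^'n"
  have "\<bar>(A + B) $ i $ j\<bar> \<le> entry_norm A + entry_norm B" for i j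
    using abs_entry_le_entry_norm[of A i j] abs_entry_le_entry_norm[of B i j] by simp
  then show "entry_norm (A + B) \<le> entry_norm A + entry_norm B"
    by (simp only: entry_norm_le_iff) blast
  have "\<bar>A $ i $ j\<bar> \<le> norm A" for i j
    using component_le_norm_cart[of "A $ i" j] Finite_Cartesian_Product.norm_nth_le[of A i] by linarith
  then show "entry_norm A \<le> 1 * norm A" by (simp add: entry_norm_le_iff)
qed

lemma continuous_on_spectral_norm: "continuous_on S (spectral_norm :: real^'n^'n \<Rightarrow> real)"
proof (rule continuous_on_seminorm)
  fix A B :: "real^'n^'n"
  show "spectral_norm (A + B) \<le> spectral_norm A + spectral_norm B"
    using onorm_triangle[of "(*v) A" "(*v) B"]
    by (simp add: spectral_norm_eq_onorm flip: matrix_vector_mult_add_rdistrib)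
  have "\<bar>A $ i $ j\<bar> \<le> norm A" for i j
    using component_le_norm_cart[of "A $ i" j] Finite_Cartesian_Product.norm_nth_le[of A i] by linarith
  then show "spectral_norm A \<le> (real CARD('n) * real CARD('n)) * norm A"
    unfolding spectral_norm_eq_onorm by (rule onorm_le_matrix_component)
qed

lemma bounded_entry_norm_le: "bounded {A :: real^'n^'n. entry_norm A \<le> c}"
proof (rule boundedI)
  fix A :: "real^'n^'n"
  assume "A \<in> {A. entry_norm A \<le> c}"
  then have A: "\<bar>A $ i $ j\<bar> \<le> c" for i j by (simp add: entry_norm_le_iff)
  have "norm A \<le> (\<Sum>i\<in>UNIV. norm (A $ i))"
    unfolding norm_vec_def by (rule L2_set_le_sum) simp
  also have "\<dots> \<le> (\<Sum>i\<in>(UNIV :: 'n set). \<Sum>j\<in>(UNIV :: 'n set). c)"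
    by (intro sum_mono order_trans[OF norm_le_l1_cart] A)
  finally show "norm A \<le> (\<Sum>i\<in>(UNIV :: 'n set). \<Sum>j\<in>(UNIV :: 'n set). c)" .
qed

text \<open>\<open>GREATEST\<close> is informative only when a maximum is attained; here the
  feasible set is closed and bounded, hence compact. For \<open>xi\<close> the constraint
  \<open>f\<close> is the spectral norm and the objective \<open>g\<close> the entry norm; for
  \<open>mu\<close> the roles are exchanged.\<close>

lemma le_Greatest_compact:
  fixes f g :: "'a::heine_borel \<Rightarrow> real"
  assumes "closed S" "continuous_on UNIV f" "continuous_on UNIV g" "bounded {x. f x \<le> 1}"
    and "x \<in> S" "f x \<le> 1"
  shows "g x \<le> (GREATEST r. \<exists>y\<in>S. f y \<le> 1 \<and> r = g y)"
proof -
  have "closed {x. f x \<le> 1}"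
    using assms(2) by (intro closed_Collect_le continuous_on_const)
  then have "compact (S \<inter> {x. f x \<le> 1})"
    using assms by (auto simp: compact_eq_bounded_closed intro: bounded_subset)
  then obtain m where m: "m \<in> S" "f m \<le> 1" "\<And>y. y \<in> S \<Longrightarrow> f y \<le> 1 \<Longrightarrow> g y \<le> g m"
    using continuous_attains_sup[of "S \<inter> {x. f x \<le> 1}" g] assms
      continuous_on_subset[of UNIV g] by auto
  then have "(GREATEST r. \<exists>y\<in>S. f y \<le> 1 \<and> r = g y) = g m"
    by (intro Greatest_equality) auto
  then show ?thesis using m assms by simp
qed

lemma closed_Omega_space: "closed (Omega_space M)"
proof -
  have "Omega_space M = (\<Inter>(i, j) \<in> - support M. {N. N $ i $ j = 0})"
    by (auto simp: Omega_space_def support_def)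
  moreover have "closed {N :: real^'n^'n. N $ i $ j = 0}" for i j
    by (intro closed_Collect_eq continuous_intros)
  ultimately show ?thesis by (auto intro!: closed_INT)
qed

section \<open>Existence of the compact singular value decomposition\<close>

lemma mult_transpose_vector:
  "mult_transpose k A B *v x = (\<Sum>l<k. (B l \<bullet> x) *\<^sub>R A l)"
  by (simp add: mult_transpose_def vec_eq_iff matrix_vector_mult_def inner_vec_def
      sum_distrib_right sum_distrib_left sum.swap[of _ "{..<k}"] ac_simps)

lemma transpose_mult_transpose: "transpose (mult_transpose k A B) = mult_transpose k B A"
  by (simp add: mult_transpose_def transpose_def vec_eq_iff mult.commute)

lemma mult_transpose_column:
  assumes "orthonormal_columns k B" "l < k"
  shows "mult_transpose k A B *v B l = A l"
proof -
  have "mult_transpose k A B *v B l = (\<Sum>m<k. if m = l then A l else 0)"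
    unfolding mult_transpose_vector
    by (rule sum.cong) (use assms in \<open>auto simp: orthonormal_columns_def\<close>)
  then show ?thesis using assms by simp
qed

lemma inner_orthonormal_sum:
  assumes "orthonormal_columns k W" "m < k"
  shows "W m \<bullet> (\<Sum>l<k. c l *\<^sub>R W l) = c m"
proof -
  have "W m \<bullet> (\<Sum>l<k. c l *\<^sub>R W l) = (\<Sum>l<k. if l = m then c m else 0)"
    unfolding inner_sum_right
    by (rule sum.cong) (use assms in \<open>auto simp: orthonormal_columns_def\<close>)
  then show ?thesis using assms by simp
qed

lemma orthonormal_residual:
  assumes "orthonormal_columns k W" "m < k"
  shows "W m \<bullet> (x - (\<Sum>l<k. (W l \<bullet> x) *\<^sub>R W l)) = 0"
  using inner_orthonormal_sum[OF assms, of "\<lambda>l. W l \<bullet> x"] by (simp add: inner_diff_right)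

text \<open>
  Induction by deflation: subtracting the leading singular component from M shrinks its range.
\<close>

lemma svd_exists:
  fixes M :: "real^'n^'n"
  shows "\<exists>k U \<sigma> V. orthonormal_columns k U \<and> orthonormal_columns k V \<and> (\<forall>l<k. 0 < \<sigma> l) \<and>
    M = mult_transpose k (\<lambda>l. \<sigma> l *\<^sub>R U l) V"
proof (induction "rank M" arbitrary: M rule: less_induct)
  case less
  show ?case
  proof (cases "M = 0")
    case True
    then show ?thesis
      by (intro exI[of _ 0]) (auto simp: orthonormal_columns_def mult_transpose_def vec_eq_iff)
  next
    case False
    define s where "s = onorm ((*v) M)"
    obtain v where v: "norm v = 1" and Mv: "transpose M *v (M *v v) = s\<^sup>2 *\<^sub>R v"
      unfolding s_def by (rule right_singular_vector_exists)
    have "s \<noteq> 0"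
      using False by (metis entry_norm_le_spectral_norm s_def spectral_norm_eq_onorm
          entry_norm_le_iff abs_le_zero_iff vec_eq_iff zero_index)
    moreover have "0 \<le> s" unfolding s_def by (simp add: onorm_pos_le)
    ultimately have s: "0 < s" by simp
    define u where "u = (1 / s) *\<^sub>R (M *v v)"
    have su: "M *v v = s *\<^sub>R u" using s by (simp add: u_def)
    have tu: "transpose M *v u = s *\<^sub>R v"
      using s by (simp add: u_def matrix_vector_mult_scaleR Mv power2_eq_square)
    have vv: "v \<bullet> v = 1" using v by (simp flip: power2_norm_eq_inner)
    have "s * (u \<bullet> u) = (M *v v) \<bullet> u" by (simp add: su)
    also have "\<dots> = s" by (simp add: inner_matrix_transpose tu vv)
    finally have uu: "u \<bullet> u = 1" using s by simp
    \<comment> \<open>The deflated matrix: it kills \<open>v\<close>, its range is orthogonal to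
      \<open>u\<close>, and it agrees with \<open>M\<close> on the orthogonal complement of
      \<open>v\<close>.\<close>
    define N where "N = M - (\<chi> i j. s * u $ i * v $ j)"
    have rank1: "(\<chi> i j. s * u $ i * v $ j) *v x = (s * (v \<bullet> x)) *\<^sub>R u" for x
      by (simp add: vec_eq_iff matrix_vector_mult_def inner_vec_def sum_distrib_left
          sum_distrib_right ac_simps)
    have Nx: "N *v x = M *v x - (s * (v \<bullet> x)) *\<^sub>R u" for x
      by (simp add: N_def matrix_vector_mult_diff_rdistrib rank1)
    have Nu: "u \<bullet> (N *v x) = 0" for x
    proof -
      have "u \<bullet> (M *v x) = x \<bullet> (transpose M *v u)"
        by (metis inner_commute inner_matrix_transpose)
      then have "u \<bullet> (M *v x) = s * (v \<bullet> x)"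
        by (simp add: tu inner_commute)
      then show ?thesis by (simp add: Nx inner_diff_right uu)
    qed
    have Nv: "N *v v = 0" by (simp add: Nx su vv)
    have "range ((*v) N) \<subseteq> range ((*v) M)"
    proof
      fix y assume "y \<in> range ((*v) N)"
      then obtain x where "y = N *v x" by auto
      then have "y = M *v (x - (v \<bullet> x) *\<^sub>R v)"
        by (simp add: Nx matrix_vector_mult_diff_distrib matrix_vector_mult_scaleR su ac_simps)
      then show "y \<in> range ((*v) M)" by simp
    qed
    \<comment> \<open>The vector \<open>u\<close> witnesses that the inclusion of ranges is strict,
      which makes the rank drop.\<close>
    moreover have "u \<in> range ((*v) M)"
      by (metis matrix_vector_mult_scaleR rangeI u_def)
    moreover have "u \<notin> range ((*v) N)"
      using Nu uu by fastforce
    ultimately have "span (range ((*v) N)) \<subset> span (range ((*v) M))"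
      by (auto simp: span_eq_iff[THEN iffD2] linear_subspace_image)
    then have "rank N < rank M"
      by (simp add: rank_dim_range dim_psubset)
    from less[OF this] obtain k U \<sigma> V where
      U: "orthonormal_columns k U" and V: "orthonormal_columns k V" and
      pos: "\<forall>l<k. 0 < \<sigma> l" and N: "N = mult_transpose k (\<lambda>l. \<sigma> l *\<^sub>R U l) V" by blast
    have NV: "N *v V l = \<sigma> l *\<^sub>R U l" if "l < k" for l
      unfolding N using mult_transpose_column[OF V that] .
    have NU: "transpose N *v U l = \<sigma> l *\<^sub>R V l" if "l < k" for l
    proof -
      have "transpose N *v U l = (\<Sum>m<k. if m = l then \<sigma> l *\<^sub>R V l else 0)"
        unfolding N transpose_mult_transpose mult_transpose_vector
        by (rule sum.cong) (use U that in \<open>auto simp: orthonormal_columns_def\<close>)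
      then show ?thesis using that by simp
    qed
    \<comment> \<open>Since \<open>\<sigma> l\<close> is nonzero, \<open>U l\<close> lies in the
      range of \<open>N\<close> and \<open>V l\<close> in that of its transpose. The first range is
      orthogonal to \<open>u\<close>, the second to the kernel vector \<open>v\<close>.\<close>
    have uU: "u \<bullet> U l = 0" if "l < k" for l
      using Nu[of "V l"] NV[OF that] pos that by auto
    have vV: "v \<bullet> V l = 0" if "l < k" for l
      using inner_matrix_transpose[of N v "U l"] Nv NU[OF that] pos that by auto
    \<comment> \<open>The components of \<open>N\<close> keep their indices, and the leading
      component takes the new index \<open>k\<close>, so the largest singular value comes
      last.\<close>
    have "orthonormal_columns (Suc k) (U(k := u))"
      using U uU uu by (auto simp: orthonormal_columns_def less_Suc_eq inner_commute)
    moreover have "orthonormal_columns (Suc k) (V(k := v))"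
      using V vV vv by (auto simp: orthonormal_columns_def less_Suc_eq inner_commute)
    moreover have "\<forall>l<Suc k. 0 < (\<sigma>(k := s)) l"
      using pos s by (auto simp: less_Suc_eq)
    moreover have "M = mult_transpose (Suc k) (\<lambda>l. (\<sigma>(k := s)) l *\<^sub>R (U(k := u)) l) (V(k := v))"
    proof -
      have "M = N + (\<chi> i j. s * u $ i * v $ j)" by (simp add: N_def)
      then show ?thesis unfolding N by (simp add: mult_transpose_def vec_eq_iff)
    qed
    ultimately show ?thesis by blast
  qed
qed

text \<open>The columns of \<open>U\<close> form a basis of the column space of \<open>M\<close>:
  they are independent by orthonormality, they span, and each is the image of \<open>V l\<close>
  divided by \<open>\<sigma> l\<close>.\<close>

lemma svd_length_eq_rank:
  fixes M :: "real^'n^'n"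
  assumes U: "orthonormal_columns k U" and V: "orthonormal_columns k V" and pos: "\<forall>l<k. 0 < \<sigma> l"
    and M: "M = mult_transpose k (\<lambda>l. \<sigma> l *\<^sub>R U l) V"
  shows "k = rank M"
proof -
  have inj: "inj_on U {..<k}"
    using U unfolding orthonormal_columns_def inj_on_def by (metis lessThan_iff zero_neq_one)
  have "independent (U ` {..<k})"
  proof (rule pairwise_orthogonal_independent)
    show "pairwise orthogonal (U ` {..<k})"
      using U by (auto simp: pairwise_def orthogonal_def orthonormal_columns_def)
    show "0 \<notin> U ` {..<k}"
      using U by (force simp: orthonormal_columns_def)
  qed
  moreover have "U l \<in> range ((*v) M)" if "l < k" for l
  proof -
    have "M *v V l = \<sigma> l *\<^sub>R U l"
      unfolding M using mult_transpose_column[OF V that] .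
    then have "M *v ((1 / \<sigma> l) *\<^sub>R V l) = U l"
      using that pos by (auto simp: matrix_vector_mult_scaleR)
    then show ?thesis by (metis rangeI)
  qed
  moreover have "range ((*v) M) \<subseteq> span (U ` {..<k})"
    unfolding M by (auto simp: mult_transpose_vector intro!: span_sum intro: span_scale span_base)
  ultimately have "dim (range ((*v) M)) = card (U ` {..<k})"
    by (intro dim_unique) auto
  then show ?thesis using inj by (simp add: rank_dim_range card_image)
qed

lemma compact_svd_exists: "\<exists>k U \<sigma> V. compact_svd M k U \<sigma> V"
proof -
  obtain k U \<sigma> V where svd: "orthonormal_columns k U" "orthonormal_columns k V" "\<forall>l<k. 0 < \<sigma> l"
    "M = mult_transpose k (\<lambda>l. \<sigma> l *\<^sub>R U l) V"
    using svd_exists[of M] by (elim exE conjE)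
  then have "compact_svd M k U \<sigma> V"
    unfolding compact_svd_def by (intro conjI svd_length_eq_rank[OF svd])
  then show ?thesis by blast
qed

lemma compact_svdD:
  assumes "compact_svd M k U \<sigma> V"
  shows "orthonormal_columns k U" and "orthonormal_columns k V" and "\<forall>l<k. 0 < \<sigma> l"
    and "M = mult_transpose k (\<lambda>l. \<sigma> l *\<^sub>R U l) V"
  using assms[unfolded compact_svd_def, THEN conjunct2]
  by - (elim conjE, assumption)+

section \<open>The space \<open>T_space M\<close>: membership of \<open>M\<close>, intrinsic
  description, closedness\<close>

lemma T_spaceI:
  assumes "compact_svd M k U \<sigma> V" and "N = mult_transpose k U X + mult_transpose k Y V"
  shows "N \<in> T_space M"
  unfolding T_space_def using assms(2,1) by (intro CollectI exI conjI)

text \<open>Take \<open>X = 0\<close> and let \<open>Y\<close> consist of the scaled columns of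
  \<open>U\<close>. Existence of a decomposition is essential, since \<open>T_space\<close>
  quantifies over decompositions existentially.\<close>

lemma in_T_space_self: "M \<in> T_space M"
proof -
  obtain k U \<sigma> V where svd: "compact_svd M k U \<sigma> V" using compact_svd_exists by blast
  have "mult_transpose k (\<lambda>l. \<sigma> l *\<^sub>R U l) V =
      mult_transpose k U (\<lambda>_. 0) + mult_transpose k (\<lambda>l. \<sigma> l *\<^sub>R U l) V"
    by (simp add: mult_transpose_def vec_eq_iff)
  with compact_svdD(4)[OF svd] show ?thesis by (intro T_spaceI[OF svd]) (rule trans)
qed

text \<open>Expanding in the orthonormal columns, the coefficients of the image are the inner
  products scaled by the nonzero \<open>\<sigma> l\<close>. This ties the column spaces of
  \<open>U\<close> and \<open>V\<close> to \<open>M\<close> alone.\<close>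

lemma compact_svd_kernel:
  assumes "compact_svd M k U \<sigma> V"
  shows "M *v x = 0 \<longleftrightarrow> (\<forall>l<k. V l \<bullet> x = 0)"
    and "transpose M *v x = 0 \<longleftrightarrow> (\<forall>l<k. U l \<bullet> x = 0)"
proof -
  note U = compact_svdD(1)[OF assms] and V = compact_svdD(2)[OF assms]
    and pos = compact_svdD(3)[OF assms] and M = compact_svdD(4)[OF assms]
  have nz: "\<sigma> l \<noteq> 0" if "l < k" for l using pos that by force
  have "M *v x = (\<Sum>l<k. (\<sigma> l * (V l \<bullet> x)) *\<^sub>R U l)"
    unfolding M mult_transpose_vector by (simp add: ac_simps)
  with inner_orthonormal_sum[OF U, of _ "\<lambda>l. \<sigma> l * (V l \<bullet> x)"] nz
  show "M *v x = 0 \<longleftrightarrow> (\<forall>l<k. V l \<bullet> x = 0)" by fastforce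
  have "transpose M *v x = (\<Sum>l<k. (\<sigma> l * (U l \<bullet> x)) *\<^sub>R V l)"
    unfolding M transpose_mult_transpose mult_transpose_vector by simp
  with inner_orthonormal_sum[OF V, of _ "\<lambda>l. \<sigma> l * (U l \<bullet> x)"] nz
  show "transpose M *v x = 0 \<longleftrightarrow> (\<forall>l<k. U l \<bullet> x = 0)" by fastforce
qed

text \<open>
  This description does not refer to a decomposition and shows that \<open>T(M)\<close> is closed.
\<close>

lemma T_space_eq:
  "T_space M = {N. \<forall>x y. M *v x = 0 \<longrightarrow> transpose M *v y = 0 \<longrightarrow> y \<bullet> (N *v x) = 0}"
    (is "_ = ?R")
proof (intro equalityI subsetI)
  fix N assume "N \<in> T_space M"
  then obtain k U \<sigma> V X Y where svd: "compact_svd M k U \<sigma> V"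
    and N: "N = mult_transpose k U X + mult_transpose k Y V"
    unfolding T_space_def by blast
  \<comment> \<open>The first summand maps into the span of the columns of \<open>U\<close>, to
    which \<open>y\<close> is orthogonal; the second annihilates \<open>x\<close>, which is
    orthogonal to the columns of \<open>V\<close>.\<close>
  show "N \<in> ?R"
    by (auto simp: N compact_svd_kernel[OF svd] matrix_vector_mult_add_rdistrib
        mult_transpose_vector inner_add_right inner_sum_right inner_commute)
next
  fix N assume N: "N \<in> ?R"
  obtain k U \<sigma> V where svd: "compact_svd M k U \<sigma> V" using compact_svd_exists by blast
  note U = compact_svdD(1)[OF svd] and V = compact_svdD(2)[OF svd]
  \<comment> \<open>The maps \<open>p\<close> and \<open>q\<close> are the orthogonal projections P
    and Q onto the column and row space of \<open>M\<close>. The choices of \<open>X\<close> and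
    \<open>Y\<close> realize the splitting N = P N + (I - P) N Q.\<close>
  define p where "p = (\<lambda>y. \<Sum>l<k. (U l \<bullet> y) *\<^sub>R U l)"
  define q where "q = (\<lambda>x. \<Sum>l<k. (V l \<bullet> x) *\<^sub>R V l)"
  define X where "X = (\<lambda>l. transpose N *v U l)"
  define Y where "Y = (\<lambda>l. N *v V l - p (N *v V l))"
  have p_sym: "p y \<bullet> z = y \<bullet> p z" for y z
    by (simp add: p_def inner_sum_left inner_sum_right inner_commute mult.commute)
  have p_lin: "linear p"
    unfolding p_def by (intro linearI) (simp_all add: inner_add_right scaleR_add_left sum.distrib scaleR_sum_right)
  have X: "mult_transpose k U X *v x = p (N *v x)" for x
    unfolding mult_transpose_vector p_def X_def
    by (simp add: inner_matrix_transpose[symmetric] inner_commute)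
  have Y: "mult_transpose k Y V *v x = N *v q x - p (N *v q x)" for x
  proof -
    have Nq: "N *v q x = (\<Sum>l<k. (V l \<bullet> x) *\<^sub>R (N *v V l))"
      unfolding q_def by (simp add: linear_sum[OF matrix_vector_mul_linear] o_def matrix_vector_mult_scaleR)
    have "p (N *v q x) = (\<Sum>l<k. (V l \<bullet> x) *\<^sub>R p (N *v V l))"
      unfolding Nq by (simp add: linear_sum[OF p_lin] linear_scale[OF p_lin])
    then show ?thesis
      unfolding mult_transpose_vector Y_def Nq by (simp add: scaleR_diff_right sum_subtractf)
  qed
  have "N *v x = (mult_transpose k U X + mult_transpose k Y V) *v x" for x
  proof -
    \<comment> \<open>The splitting leaves the remainder (I - P) N (I - Q), which vanishes because I
      - Q maps into the kernel of \<open>M\<close> and I - P into that of its transpose.\<close>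
    define z where "z = N *v (x - q x)"
    have "M *v (x - q x) = 0"
      by (auto simp: compact_svd_kernel[OF svd] q_def orthonormal_residual[OF V])
    moreover have "transpose M *v (y - p y) = 0" for y
      by (auto simp: compact_svd_kernel[OF svd] p_def orthonormal_residual[OF U])
    ultimately have "(y - p y) \<bullet> z = 0" for y
      using N z_def by blast
    then have "y \<bullet> (z - p z) = 0" for y
      by (simp add: inner_diff_left inner_diff_right p_sym)
    then have "z = p z" by (metis inner_eq_zero_iff right_minus_eq)
    then show ?thesis
      by (simp add: z_def matrix_vector_mult_add_rdistrib X Y matrix_vector_mult_diff_distrib
          linear_diff[OF p_lin] algebra_simps)
  qed
  then have "N = mult_transpose k U X + mult_transpose k Y V"
    by (simp add: matrix_eq)
  then show "N \<in> T_space M" by (rule T_spaceI[OF svd])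
qed

lemma T_space_scaleR: "N \<in> T_space M \<Longrightarrow> c *\<^sub>R N \<in> T_space M"
  by (simp add: T_space_eq flip: scaleR_matrix_vector_assoc)

text \<open>By \<open>T_space_eq\<close> the space is cut out by equations in \<open>N\<close>, one
  for each pair of kernel vectors, and each equation is continuous in \<open>N\<close>.\<close>

lemma closed_T_space: "closed (T_space M)"
proof -
  have "continuous_on UNIV (\<lambda>N :: real^'n^'n. y \<bullet> (N *v x))" for x y
    unfolding inner_vec_def matrix_vector_mult_def by (simp, intro continuous_intros)
  then show ?thesis
    unfolding T_space_eq
    by (intro closed_Collect_all closed_Collect_imp open_Collect_const closed_Collect_eq
        continuous_on_const)
qed

theorem theorem1:
  fixes M :: "real^'n^'n"
  assumes "M \<noteq> 0"
  shows "xi M * mu M \<ge> 1"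
proof -
  define e where "e = entry_norm M"
  define s where "s = spectral_norm M"
  have "0 < e"
    using assms abs_entry_le_entry_norm[of M] unfolding e_def
    by (metis abs_le_zero_iff less_le_trans not_le vec_eq_iff zero_index)
  then have "0 < s"
    using entry_norm_le_spectral_norm[of M] by (simp add: e_def s_def)
  have "bounded {N :: real^'n^'n. spectral_norm N \<le> 1}"
    using bounded_entry_norm_le[of 1] entry_norm_le_spectral_norm
    by (rule_tac bounded_subset) (auto intro: order_trans)
  then have "entry_norm ((1 / s) *\<^sub>R M) \<le> xi M"
    unfolding xi_def using \<open>0 < s\<close>
    by (intro le_Greatest_compact closed_T_space continuous_on_spectral_norm
        continuous_on_entry_norm T_space_scaleR in_T_space_self)
      (auto simp: spectral_norm_scaleR s_def)
  then have xi: "e / s \<le> xi M"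
    using \<open>0 < s\<close> by (simp add: entry_norm_scaleR e_def)
  have "spectral_norm ((1 / e) *\<^sub>R M) \<le> mu M"
    unfolding mu_def using \<open>0 < e\<close>
    by (intro le_Greatest_compact closed_Omega_space continuous_on_spectral_norm
        continuous_on_entry_norm bounded_entry_norm_le)
      (auto simp: entry_norm_scaleR e_def Omega_space_def support_def)
  then have mu: "s / e \<le> mu M"
    using \<open>0 < e\<close> by (simp add: spectral_norm_scaleR s_def)
  have "1 = (e / s) * (s / e)" using \<open>0 < e\<close> \<open>0 < s\<close> by simp
  \<comment> \<open>Multiplying the two bounds requires \<open>xi M\<close> to be nonnegative, which
    follows from the positive lower bound \<open>e / s\<close>.\<close>
  also have "\<dots> \<le> xi M * mu M"
    using xi mu \<open>0 < e\<close> \<open>0 < s\<close> by (intro mult_mono) (auto intro: order_trans[of _ "e / s"])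
  finally show ?thesis .
qed

end
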